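(* Fix any adversary, either unilateral or bilateral link formation, and any equilibrium concept, i.e. for all integers $n\ge3$ and reals $\alpha>0$ a set $\mathcal{E}(n,\alpha)$ of essential strategy profiles with connected final graph (the equilibria). (i) If there is a constant $c>0$ such that for all $n,\alpha$ every $S\in\mathcal{E}(n,\alpha)$ satisfies $|E(S)|\le cn$, then the price of anarchy is $O(1+\frac n\alpha)$: there is a constant $K>0$ (independent of $n$ and $\alpha$) such that $C(S)\le K\,(1+\frac n\alpha)\,\mathrm{OPT}(n,\alpha)$ for all $n\ge3$, $\alpha>0$ and $S\in\mathcal{E}(n,\alpha)$. (ii) If there is a constant $c>0$ as in (i) and moreover $\alpha=\Omega(n)$, then the price of anarchy is $O(1)$: for every constant $c'>0$ there is a constant $K>0$ such that $C(S)\le K\,\mathrm{OPT}(n,\alpha)$ for all $n\ge 3$, all $\alpha\ge c'n$ and all $S\in\mathcal{E}(n,\alpha)$.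
   Context: Players are $V=\{1,\dots,n\}$ ($n\ge 3$), link cost is $\alpha>0$. A strategy profile is a matrix $S\in\{0,1\}^{n\times n}$ with $S_{vv}=0$; for $v\ne w$, $S_{vw}=1$ means that player $v$ requests the edge $\{v,w\}$. The final graph $G(S)=(V,E(S))$ is the simple undirected graph in which $\{v,w\}\in E(S)$ iff $S_{vw}=1$ or $S_{wv}=1$ (unilateral link formation), respectively iff $S_{vw}=1$ and $S_{wv}=1$ (bilateral link formation). $S$ is essential if $S_{vw}=1\Rightarrow S_{wv}=0$ (unilateral), respectively $S_{vw}=1\Rightarrow S_{wv}=1$ (bilateral). An adversary assigns to each graph $G=(V,E)$ a probability measure $\Pr_G$ on $E$. For a connected graph $G$, $e\in E$, $v\in V$, the relevance $\mathrm{rel}_G(e,v)$ is the number of vertices that, starting at $v$, can only be reached via $e$ (so it is $0$ iff $e$ is not a bridge). The disconnection cost of $v$ is $I_v(G)=\sum_{e\in E}\mathrm{rel}_G(e,v)\Pr_G(\{e\})$ if $G$ is connected and $I_v(G)=\infty$ otherwise. Individual cost: $C_v(S)=\alpha\sum_{w}S_{vw}+I_v(G(S))$. Social cost: $C(S)=\sum_{v}C_v(S)$. $\mathrm{OPT}(n,\alpha)$ is the minimum social cost over all strategy profiles. The price of anarchy is $\max_{S\in\mathcal{E}(n,\alpha)}C(S)/\mathrm{OPT}(n,\alpha)$. *)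

theory Defs
  imports "HOL-Probability.Probability"
begin

type_synonym graph = "nat set \<times> nat set set"

abbreviation verts :: "graph \<Rightarrow> nat set" where "verts \<equiv> fst"
abbreviation edges :: "graph \<Rightarrow> nat set set" where "edges \<equiv> snd"

definition simple_graph :: "graph \<Rightarrow> bool" where
  "simple_graph G \<longleftrightarrow> finite (verts G) \<and> (\<forall>e\<in>edges G. e \<subseteq> verts G \<and> card e = 2)"

fun walk_edges :: "nat list \<Rightarrow> nat set list" where
  "walk_edges [] = []"
| "walk_edges [v] = []"
| "walk_edges (v # w # p) = {v, w} # walk_edges (w # p)"

definition walk_betw :: "graph \<Rightarrow> nat \<Rightarrow> nat list \<Rightarrow> nat \<Rightarrow> bool" where
  "walk_betw G v p w \<longleftrightarrow> p \<noteq> [] \<and> hd p = v \<and> last p = w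
     \<and> set p \<subseteq> verts G \<and> set (walk_edges p) \<subseteq> edges G"

definition connected_graph :: "graph \<Rightarrow> bool" where
  "connected_graph G \<longleftrightarrow> verts G \<noteq> {} \<and> (\<forall>v\<in>verts G. \<forall>w\<in>verts G. \<exists>p. walk_betw G v p w)"

definition relevance :: "graph \<Rightarrow> nat set \<Rightarrow> nat \<Rightarrow> nat" where
  "relevance G e v = card {w \<in> verts G. \<forall>p. walk_betw G v p w \<longrightarrow> e \<in> set (walk_edges p)}"

text \<open>An edgeless graph carries no probability measure on its edges, hence the
  condition that there be an edge. All connected graphs on at least two vertices satisfy it.\<close>

type_synonym adversary = "graph \<Rightarrow> nat set pmf"

definition is_adversary :: "adversary \<Rightarrow> bool" where
  "is_adversary Pr \<longleftrightarrow>
     (\<forall>G. simple_graph G \<and> edges G \<noteq> {} \<longrightarrow> set_pmf (Pr G) \<subseteq> edges G)"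

definition disconnection_cost :: "adversary \<Rightarrow> graph \<Rightarrow> nat \<Rightarrow> ereal" where
  "disconnection_cost Pr G v =
     (if connected_graph G then ereal (\<Sum>e\<in>edges G. real (relevance G e v) * pmf (Pr G) e)
      else \<infinity>)"

datatype link_formation = Unilateral | Bilateral

abbreviation players :: "nat \<Rightarrow> nat set" where "players n \<equiv> {1..n}"

text \<open>An \<open>n \<times> n\<close> matrix over \<open>{0, 1}\<close> is represented by a function that vanishes
  outside the index range, so that distinct profiles are distinct functions.\<close>

type_synonym profile = "nat \<Rightarrow> nat \<Rightarrow> nat"

definition strategy_profiles :: "nat \<Rightarrow> profile set" where
  "strategy_profiles n =
     {S. (\<forall>v w. S v w \<in> {0, 1}) \<and> (\<forall>v. S v v = 0)
       \<and> (\<forall>v w. v \<notin> players n \<or> w \<notin> players n \<longrightarrow> S v w = 0)}"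

fun linked :: "link_formation \<Rightarrow> profile \<Rightarrow> nat \<Rightarrow> nat \<Rightarrow> bool" where
  "linked Unilateral S v w \<longleftrightarrow> S v w = 1 \<or> S w v = 1"
| "linked Bilateral S v w \<longleftrightarrow> S v w = 1 \<and> S w v = 1"

definition final_graph :: "link_formation \<Rightarrow> nat \<Rightarrow> profile \<Rightarrow> graph" where
  "final_graph lf n S =
     (players n, {{v, w} | v w. v \<in> players n \<and> w \<in> players n \<and> v \<noteq> w \<and> linked lf S v w})"

fun essential :: "link_formation \<Rightarrow> profile \<Rightarrow> bool" where
  "essential Unilateral S \<longleftrightarrow> (\<forall>v w. S v w = 1 \<longrightarrow> S w v = 0)"
| "essential Bilateral S \<longleftrightarrow> (\<forall>v w. S v w = 1 \<longrightarrow> S w v = 1)"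

definition individual_cost ::
  "adversary \<Rightarrow> link_formation \<Rightarrow> nat \<Rightarrow> real \<Rightarrow> profile \<Rightarrow> nat \<Rightarrow> ereal" where
  "individual_cost Pr lf n \<alpha> S v =
     ereal (\<alpha> * (\<Sum>w\<in>players n. real (S v w))) + disconnection_cost Pr (final_graph lf n S) v"

definition social_cost :: "adversary \<Rightarrow> link_formation \<Rightarrow> nat \<Rightarrow> real \<Rightarrow> profile \<Rightarrow> ereal" where
  "social_cost Pr lf n \<alpha> S = (\<Sum>v\<in>players n. individual_cost Pr lf n \<alpha> S v)"

definition OPT :: "adversary \<Rightarrow> link_formation \<Rightarrow> nat \<Rightarrow> real \<Rightarrow> ereal" where
  "OPT Pr lf n \<alpha> = Min (social_cost Pr lf n \<alpha> ` strategy_profiles n)"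

text \<open>\<^const>\<open>Min\<close> is only specified on finite nonempty sets.\<close>

lemma finite_strategy_profiles: "finite (strategy_profiles n)"
proof (rule finite_subset)
  let ?mat = "\<lambda>A v w. if (v, w) \<in> A then 1 else (0::nat)"
  show "strategy_profiles n \<subseteq> ?mat ` Pow (players n \<times> players n)"
  proof
    fix S assume S: "S \<in> strategy_profiles n"
    have in01: "S v w = 0 \<or> S v w = 1" for v w
      using S by (auto simp: strategy_profiles_def)
    have mat: "S = ?mat {(v, w). S v w = 1}"
    proof (intro ext)
      show "S v w = ?mat {(v, w). S v w = 1} v w" for v w
        using in01[of v w] by auto
    qed
    have off: "\<forall>v w. v \<notin> players n \<or> w \<notin> players n \<longrightarrow> S v w = 0"
      using S unfolding strategy_profiles_def by blast
    have "v \<in> players n \<and> w \<in> players n" if "S v w = 1" for v w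
      using off[rule_format, of v w] that by (cases "v \<notin> players n \<or> w \<notin> players n") simp_all
    then have "{(v, w). S v w = 1} \<in> Pow (players n \<times> players n)"
      by blast
    with mat show "S \<in> ?mat ` Pow (players n \<times> players n)"
      by (rule image_eqI)
  qed
qed simp

lemma strategy_profiles_nonempty: "strategy_profiles n \<noteq> {}"
proof -
  have "(\<lambda>v w. 0) \<in> strategy_profiles n" by (simp add: strategy_profiles_def)
  then show ?thesis by blast
qed

definition equilibrium_concept :: "link_formation \<Rightarrow> (nat \<Rightarrow> real \<Rightarrow> profile set) \<Rightarrow> bool" where
  "equilibrium_concept lf \<E> \<longleftrightarrow>
     (\<forall>n \<alpha>. n \<ge> 3 \<longrightarrow> \<alpha> > 0 \<longrightarrow>
        (\<forall>S\<in>\<E> n \<alpha>. S \<in> strategy_profiles n \<and> essential lf S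
           \<and> connected_graph (final_graph lf n S)))"

definition linearly_many_edges ::
  "link_formation \<Rightarrow> (nat \<Rightarrow> real \<Rightarrow> profile set) \<Rightarrow> real \<Rightarrow> bool" where
  "linearly_many_edges lf \<E> c \<longleftrightarrow>
     (\<forall>n \<alpha>. n \<ge> 3 \<longrightarrow> \<alpha> > 0 \<longrightarrow>
        (\<forall>S\<in>\<E> n \<alpha>. real (card (edges (final_graph lf n S))) \<le> c * real n))"

end

theory Submission
  imports Defs
begin

text \<open>A single edge disconnects each player from at most \<open>n\<close> others, so the total
  disconnection cost is at most \<open>n\<^sup>2\<close>, and by essentiality an equilibrium pays for each
  edge at most twice. Hence \<open>C(S) \<le> 2 c \<alpha> n + n\<^sup>2\<close>. Conversely, a profile of finite
  cost has no isolated vertex, so at least \<open>n / 2\<close> edge requests are made and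
  \<open>OPT \<ge> \<alpha> n / 2\<close>. The quotient is at most \<open>4 c + 2 n / \<alpha>\<close>.\<close>

abbreviation requests :: "nat \<Rightarrow> profile \<Rightarrow> real" where
  "requests n S \<equiv> \<Sum>v\<in>players n. \<Sum>w\<in>players n. real (S v w)"

lemma relevance_le_card_verts:
  assumes "finite (verts G)"
  shows "relevance G e v \<le> card (verts G)"
  unfolding relevance_def using assms by (intro card_mono) auto

lemma disconnection_cost_nonneg: "disconnection_cost Pr G v \<ge> 0"
  by (auto simp: disconnection_cost_def intro!: sum_nonneg)

text \<open>The weights \<open>pmf (Pr G) e\<close> of the relevances sum over the edges to a
  probability, hence to at most 1.\<close>

lemma disconnection_cost_le_card_verts:
  assumes "connected_graph G" "finite (verts G)" "finite (edges G)"
  shows "disconnection_cost Pr G v \<le> ereal (real (card (verts G)))"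
proof -
  have "(\<Sum>e\<in>edges G. real (relevance G e v) * pmf (Pr G) e)
      \<le> (\<Sum>e\<in>edges G. real (card (verts G)) * pmf (Pr G) e)"
    by (intro sum_mono mult_right_mono)
      (use relevance_le_card_verts[OF assms(2)] in auto)
  also have "\<dots> = real (card (verts G)) * measure (Pr G) (edges G)"
    using assms(3) by (simp add: sum_distrib_left measure_measure_pmf_finite)
  also have "\<dots> \<le> real (card (verts G))"
    by (intro mult_left_le) auto
  finally show ?thesis using assms(1) by (simp add: disconnection_cost_def)
qed

lemma connected_graph_exists_incident_edge:
  assumes "connected_graph G" "v \<in> verts G" "w \<in> verts G" "v \<noteq> w"
  obtains u where "u \<in> verts G" "{v, u} \<in> edges G"
proof -
  from assms obtain p where p: "walk_betw G v p w"
    unfolding connected_graph_def by blast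
  \<comment> \<open>A one-vertex walk would force \<open>v = w\<close>, so the walk has a first
    edge.\<close>
  with \<open>v \<noteq> w\<close> obtain u q where "p = v # u # q"
    unfolding walk_betw_def by (cases p rule: walk_edges.cases) auto
  with p that show thesis unfolding walk_betw_def by auto
qed

lemma verts_final_graph [simp]: "verts (final_graph lf n S) = players n"
  by (simp add: final_graph_def)

lemma linked_sym: "linked lf S v w \<longleftrightarrow> linked lf S w v"
  by (cases lf) auto

lemma edge_final_graph_iff:
  "{v, w} \<in> edges (final_graph lf n S) \<longleftrightarrow>
     v \<in> players n \<and> w \<in> players n \<and> v \<noteq> w \<and> linked lf S v w"
  using linked_sym by (auto simp: final_graph_def doubleton_eq_iff)

lemma finite_edges_final_graph: "finite (edges (final_graph lf n S))"
  by (rule finite_subset[of _ "Pow (players n)"]) (auto simp: final_graph_def)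

text \<open>Separates the always finite link costs from the possibly infinite disconnection costs,
  so that each can be bounded on its own.\<close>

lemma social_cost_eq:
  "social_cost Pr lf n \<alpha> S = ereal (\<alpha> * requests n S)
     + (\<Sum>v\<in>players n. disconnection_cost Pr (final_graph lf n S) v)"
  by (simp add: social_cost_def individual_cost_def sum.distrib sum_distrib_left)

text \<open>Each request is charged to the edge between its two players; an edge is charged at most
  once per direction.\<close>

lemma requests_le_edges:
  assumes S: "S \<in> strategy_profiles n" and ess: "essential lf S"
  shows "requests n S \<le> 2 * real (card (edges (final_graph lf n S)))"
proof -
  let ?E = "edges (final_graph lf n S)"
  let ?R = "{(v, w). v \<in> players n \<and> w \<in> players n \<and> S v w = 1}"
  have "S v w \<in> {0, 1}" for v w
    using S by (auto simp: strategy_profiles_def)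
  then have "real (S v w) = indicator ?R (v, w)" if "v \<in> players n" "w \<in> players n" for v w
    using that by (fastforce simp: indicator_def)
  then have "requests n S = (\<Sum>v\<in>players n. \<Sum>w\<in>players n. indicator ?R (v, w))"
    by simp
  also have "\<dots> = (\<Sum>x\<in>players n \<times> players n. indicator ?R x)"
    by (simp add: sum.cartesian_product)
  also have "\<dots> = real (card ((players n \<times> players n) \<inter> ?R))"
    by (simp add: indicator_def of_bool_def sum.If_cases Int_def)
  also have "(players n \<times> players n) \<inter> ?R = ?R"
    by auto
  also have "card ?R \<le> card (?E \<times> (UNIV :: bool set))"
  proof (rule card_inj_on_le)
    \<comment> \<open>The Boolean \<open>v < w\<close> records the direction of the request, which
      the unordered pair forgets.\<close>
    show "inj_on (\<lambda>(v, w). ({v, w}, v < w)) ?R"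
      by (auto simp: inj_on_def doubleton_eq_iff)
    have "S v v = 0" for v
      using S by (simp add: strategy_profiles_def)
    \<comment> \<open>Essentiality matters in the bilateral case: the request is reciprocated and so
      yields an edge.\<close>
    moreover have "linked lf S v w" if "S v w = 1" for v w
      using ess that by (cases lf) auto
    ultimately have "v \<noteq> w \<and> linked lf S v w" if "S v w = 1" for v w
      using that by (metis zero_neq_one)
    then show "(\<lambda>(v, w). ({v, w}, v < w)) ` ?R \<subseteq> ?E \<times> UNIV"
      by (auto simp: edge_final_graph_iff)
    show "finite (?E \<times> (UNIV :: bool set))"
      by (simp add: finite_edges_final_graph)
  qed
  finally show ?thesis by (simp add: card_cartesian_product mult.commute)
qed

lemma social_cost_upper_bound:
  assumes "S \<in> strategy_profiles n" "essential lf S" "\<alpha> \<ge> 0"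
    and con: "connected_graph (final_graph lf n S)"
  shows "social_cost Pr lf n \<alpha> S
    \<le> ereal (2 * \<alpha> * real (card (edges (final_graph lf n S))) + (real n)\<^sup>2)"
proof -
  let ?G = "final_graph lf n S"
  have "(\<Sum>v\<in>players n. disconnection_cost Pr ?G v) \<le> (\<Sum>v\<in>players n. ereal (real n))"
    using disconnection_cost_le_card_verts[OF con] finite_edges_final_graph
    by (intro sum_mono) auto
  also have "\<dots> = ereal ((real n)\<^sup>2)"
    by (simp add: power2_eq_square)
  finally have "(\<Sum>v\<in>players n. disconnection_cost Pr ?G v) \<le> ereal ((real n)\<^sup>2)" .
  moreover have "\<alpha> * requests n S \<le> 2 * \<alpha> * real (card (edges ?G))"
    using mult_left_mono[OF requests_le_edges[OF assms(1,2)] \<open>\<alpha> \<ge> 0\<close>] by (simp add: mult_ac)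
  ultimately show ?thesis
    unfolding social_cost_eq plus_ereal.simps(1)[symmetric] by (intro add_mono) auto
qed

text \<open>Every player sends or receives a request. Summed over all players, each request counts
  twice, once for its sender and once for its receiver.\<close>

lemma requests_ge_half:
  assumes "n \<ge> 2" and con: "connected_graph (final_graph lf n S)"
  shows "real n / 2 \<le> requests n S"
proof -
  have "1 \<le> (\<Sum>w\<in>players n. real (S v w) + real (S w v))" if v: "v \<in> players n" for v
  proof -
    \<comment> \<open>Any second player serves as the target of a walk from \<open>v\<close>; one
      exists as \<open>n \<ge> 2\<close>.\<close>
    obtain w where "w \<in> players n" "v \<noteq> w"
      using \<open>n \<ge> 2\<close> by (intro that[of "if v = 1 then 2 else 1"]) auto
    then obtain u where u: "u \<in> players n" "{v, u} \<in> edges (final_graph lf n S)"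
      using connected_graph_exists_incident_edge[OF con, of v w] v by auto
    then have "linked lf S v u"
      by (simp add: edge_final_graph_iff)
    then have "1 \<le> real (S v u) + real (S u v)"
      by (cases lf) auto
    also have "\<dots> \<le> (\<Sum>w\<in>players n. real (S v w) + real (S w v))"
      using u by (intro member_le_sum) auto
    finally show ?thesis .
  qed
  then have "(\<Sum>v\<in>players n. 1) \<le> (\<Sum>v\<in>players n. \<Sum>w\<in>players n. real (S v w) + real (S w v))"
    by (intro sum_mono)
  also have "\<dots> = requests n S + (\<Sum>v\<in>players n. \<Sum>w\<in>players n. real (S w v))"
    by (simp add: sum.distrib)
  \<comment> \<open>Requests received and requests sent have the same total.\<close>
  also have "(\<Sum>v\<in>players n. \<Sum>w\<in>players n. real (S w v)) = requests n S"
    by (rule sum.swap)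
  finally show ?thesis by simp
qed

text \<open>Connected profiles pay for at least \<open>n / 2\<close> requests; all others cost
  infinity. The bound therefore passes to the minimum over all profiles.\<close>

lemma social_cost_lower_bound:
  assumes "n \<ge> 2" "\<alpha> \<ge> 0"
  shows "ereal (\<alpha> * real n / 2) \<le> social_cost Pr lf n \<alpha> S"
proof (cases "connected_graph (final_graph lf n S)")
  case True
  have "\<alpha> * real n / 2 \<le> \<alpha> * requests n S"
    using mult_left_mono[OF requests_ge_half[OF \<open>n \<ge> 2\<close> True] \<open>\<alpha> \<ge> 0\<close>] by simp
  then have "ereal (\<alpha> * real n / 2) + 0 \<le> social_cost Pr lf n \<alpha> S"
    unfolding social_cost_eq
    by (intro add_mono sum_nonneg disconnection_cost_nonneg) simp
  then show ?thesis by simp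
next
  case False
  then have "(\<Sum>v\<in>players n. disconnection_cost Pr (final_graph lf n S) v) = \<infinity>"
    using \<open>n \<ge> 2\<close> by (auto simp: disconnection_cost_def sum_Pinfty)
  then show ?thesis by (simp add: social_cost_eq)
qed

lemma OPT_lower_bound:
  assumes "n \<ge> 2" "\<alpha> \<ge> 0"
  shows "ereal (\<alpha> * real n / 2) \<le> OPT Pr lf n \<alpha>"
  unfolding OPT_def
  using finite_strategy_profiles strategy_profiles_nonempty social_cost_lower_bound[OF assms]
  by (intro Min.boundedI) auto

text \<open>The threshold for \<open>K\<close> is the upper bound
  \<open>2 * c * \<alpha> * n + n^2\<close> divided by the lower bound
  \<open>\<alpha> * n / 2\<close>. Leaving \<open>K\<close> free serves both parts of the
  theorem.\<close>

lemma linearly_many_edges_price_of_anarchy: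
  assumes eq: "equilibrium_concept lf \<E>" and lin: "linearly_many_edges lf \<E> c"
    and "n \<ge> 3" "\<alpha> > 0" "S \<in> \<E> n \<alpha>" and K: "4 * c + 2 * real n / \<alpha> \<le> K" "K \<ge> 0"
  shows "social_cost Pr lf n \<alpha> S \<le> ereal K * OPT Pr lf n \<alpha>"
proof -
  have S: "S \<in> strategy_profiles n" "essential lf S" "connected_graph (final_graph lf n S)"
    and m: "real (card (edges (final_graph lf n S))) \<le> c * real n"
    using assms(1-5) by (auto simp: equilibrium_concept_def linearly_many_edges_def)
  have "2 * \<alpha> * real (card (edges (final_graph lf n S))) + (real n)\<^sup>2
      \<le> 2 * \<alpha> * (c * real n) + (real n)\<^sup>2"
    using m \<open>\<alpha> > 0\<close> by simp
  also have "\<dots> = (4 * c + 2 * real n / \<alpha>) * (\<alpha> * real n / 2)"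
    using \<open>\<alpha> > 0\<close> by (simp add: field_simps power2_eq_square)
  also have "\<dots> \<le> K * (\<alpha> * real n / 2)"
    using K \<open>\<alpha> > 0\<close> by (intro mult_right_mono) auto
  finally have "social_cost Pr lf n \<alpha> S \<le> ereal K * ereal (\<alpha> * real n / 2)"
    using social_cost_upper_bound[OF S(1,2) _ S(3), of \<alpha> Pr] \<open>\<alpha> > 0\<close>
    by (auto elim: order_trans)
  also have "\<dots> \<le> ereal K * OPT Pr lf n \<alpha>"
    using OPT_lower_bound[of n \<alpha>] assms(3,4) K(2) by (intro ereal_mult_left_mono) auto
  finally show ?thesis .
qed

theorem corollary6p2:
  fixes Pr :: adversary and lf :: link_formation and \<E> :: "nat \<Rightarrow> real \<Rightarrow> profile set"
  assumes "is_adversary Pr" and "equilibrium_concept lf \<E>"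
  shows
    "((\<exists>c>0. linearly_many_edges lf \<E> c) \<longrightarrow>
        (\<exists>K>0::real. \<forall>n::nat. \<forall>\<alpha>::real. n \<ge> 3 \<longrightarrow> \<alpha> > 0 \<longrightarrow>
           (\<forall>S\<in>\<E> n \<alpha>. social_cost Pr lf n \<alpha> S \<le> ereal (K * (1 + real n / \<alpha>)) * OPT Pr lf n \<alpha>)))
     \<and> ((\<exists>c>0. linearly_many_edges lf \<E> c) \<longrightarrow>
        (\<forall>c'>0::real. \<exists>K>0::real. \<forall>n::nat. \<forall>\<alpha>::real. n \<ge> 3 \<longrightarrow> \<alpha> \<ge> c' * real n \<longrightarrow>
           (\<forall>S\<in>\<E> n \<alpha>. social_cost Pr lf n \<alpha> S \<le> ereal K * OPT Pr lf n \<alpha>)))"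
proof (intro conjI impI allI)
  assume "\<exists>c>0. linearly_many_edges lf \<E> c"
  then obtain c where c: "c > 0" "linearly_many_edges lf \<E> c" by blast
  note bound = linearly_many_edges_price_of_anarchy[OF assms(2) c(2)]
  \<comment> \<open>The right side exceeds the left by \<open>2 + 4 * c * n / \<alpha>\<close>,
    which is positive.\<close>
  have le: "4 * c + 2 * real n / \<alpha> \<le> (4 * c + 2) * (1 + real n / \<alpha>)"
    if "\<alpha> > 0" for n and \<alpha> :: real
    using c(1) that by (simp add: field_simps)
  show "\<exists>K>0. \<forall>n \<alpha>. n \<ge> 3 \<longrightarrow> \<alpha> > 0 \<longrightarrow>
      (\<forall>S\<in>\<E> n \<alpha>. social_cost Pr lf n \<alpha> S \<le> ereal (K * (1 + real n / \<alpha>)) * OPT Pr lf n \<alpha>)"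
    using bound le c(1) by (intro exI[of _ "4 * c + 2"]) auto
next
  fix c' :: real
  assume "\<exists>c>0. linearly_many_edges lf \<E> c" and c': "c' > 0"
  then obtain c where c: "c > 0" "linearly_many_edges lf \<E> c" by blast
  note bound = linearly_many_edges_price_of_anarchy[OF assms(2) c(2)]
  show "\<exists>K>0. \<forall>n \<alpha>. n \<ge> 3 \<longrightarrow> \<alpha> \<ge> c' * real n \<longrightarrow>
      (\<forall>S\<in>\<E> n \<alpha>. social_cost Pr lf n \<alpha> S \<le> ereal K * OPT Pr lf n \<alpha>)"
  \<comment> \<open>This is the threshold \<open>4 * c + 2 * n / \<alpha>\<close> with
    \<open>n / \<alpha>\<close> replaced by its upper bound \<open>1 / c'\<close>.\<close>
  proof (intro exI[of _ "4 * c + 2 / c'"] conjI allI impI ballI)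
    show "4 * c + 2 / c' > 0" using c(1) c' by (simp add: add_pos_pos)
    fix n \<alpha> S assume n: "(3::nat) \<le> n" and \<alpha>: "c' * real n \<le> \<alpha>" and S: "S \<in> \<E> n \<alpha>"
    \<comment> \<open>Part (ii) does not assume positivity; it follows from
      \<open>\<alpha> \<ge> c' * n > 0\<close>.\<close>
    have pos: "\<alpha> > 0"
      using n c' \<alpha> by (intro less_le_trans[OF _ \<alpha>]) simp
    then have "real n / \<alpha> \<le> 1 / c'"
      using \<alpha> c' by (simp add: field_simps)
    then show "social_cost Pr lf n \<alpha> S \<le> ereal (4 * c + 2 / c') * OPT Pr lf n \<alpha>"
      using c(1) c' by (intro bound n pos S) auto
  qed
qed

end
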